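(* Let $(x_k)_{k\ge 0}$ be generated by the inexact proximal-gradient iteration $x_{k+1}=\operatorname{prox}_{1/L}\{x_k-\tfrac1L(\nabla f(x_k)+e_k)\}$ described in the context. Assume that, for some $\sigma>0$, $\mathbf E[\exp(\theta\|e_k\|^2)\mid\mathcal F_{k-1}]$ is finite for $\theta\in[0,\sigma)$, and that for each $k$ there is a deterministic function $\bar\gamma_k:\mathbb R_+\to\mathbb R_+\cup\{\infty\}$ such that $$\bar\gamma_k(0)=1\quad\text{and}\quad \mathbf E[\exp(\theta\|e_k\|^2)\mid\mathcal F_{k-1}]\le\bar\gamma_k(\theta)\ \text{ for all }\theta\ge 0 .$$ Then, for $k\ge 1$ and $\epsilon>0$, $$\Pr(\pi_k-\rho^k\pi_0\ge\epsilon)\le\inf_{\theta>0}\left\{\exp(-\theta\vartheta\epsilon)\prod_{i=0}^{k-1}\bar\gamma_i(\theta\rho^{k-i-1})\right\}.$$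
   Context: Setting. $f:\mathbb R^n\to\mathbb R$ is differentiable, $g:\mathbb R^n\to(-\infty,+\infty]$ is proper, convex and lower semicontinuous, $h:=f+g$, and the solution set $\mathcal S:=\arg\min h$ is nonempty. $\|\cdot\|$ is the Euclidean norm. For $\alpha>0$, $\operatorname{prox}_\alpha\{z\}:=\arg\min_y\{\alpha g(y)+\tfrac12\|z-y\|^2\}$. There are constants $L>0$ and $\tau\ge 1$ such that for all $x,y\in\mathbb R^n$: $\|\nabla f(y)-\nabla f(x)\|\le L\|y-x\|$, and $\min_{\bar x\in\mathcal S}\|x-\bar x\|\le\tau\,\|x-\operatorname{prox}_{1/L}\{x-\tfrac1L\nabla f(x)\}\|$. The iteration starts from a deterministic $x_0\in\operatorname{dom} g$, and $e_k$ ($k\ge 0$) are random vectors in $\mathbb R^n$. The optimality gap is $\pi_k:=h(x_k)-\inf h$. $\mathcal F_k$ is the $\sigma$-algebra generated by $e_0,\dots,e_k$ ($\mathcal F_{-1}$ trivial). Conditional (in)equalities hold almost surely. Constants: $\rho:=\frac{40\tau^2}{1+40\tau^2}$, $\vartheta:=L\,\frac{1+40\tau^2}{40\tau^2}$. *)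

theory Defs
  imports "HOL-Probability.Probability"
begin

(* The three parts of "g is a proper, convex, lower semicontinuous function into
   (-infinity, +infinity]" for an ereal-valued g. *)

definition proper_fun :: "('a \<Rightarrow> ereal) \<Rightarrow> bool" where
  "proper_fun g \<longleftrightarrow> (\<forall>x. g x \<noteq> -\<infinity>) \<and> (\<exists>x. g x < \<infinity>)"

(* Restricting t to the open interval avoids the products 0 * \<infinity>. *)
definition convex_fun :: "('a::real_vector \<Rightarrow> ereal) \<Rightarrow> bool" where
  "convex_fun g \<longleftrightarrow>
     (\<forall>x y. \<forall>t\<in>{0<..<1::real}.
        g ((1 - t) *\<^sub>R x + t *\<^sub>R y) \<le> ereal (1 - t) * g x + ereal t * g y)"

definition lsc_fun :: "('a::topological_space \<Rightarrow> ereal) \<Rightarrow> bool" where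
  "lsc_fun g \<longleftrightarrow> (\<forall>x. g x \<le> Liminf (at x) g)"

definition effective_domain :: "('a \<Rightarrow> ereal) \<Rightarrow> 'a set" where
  "effective_domain g = {x. g x < \<infinity>}"

definition argmin_set :: "('a \<Rightarrow> ereal) \<Rightarrow> 'a set" where
  "argmin_set h = {x. is_arg_min h (\<lambda>_. True) x}"

definition opt_gap :: "('a \<Rightarrow> ereal) \<Rightarrow> 'a \<Rightarrow> ereal" where
  "opt_gap h x = h x - (INF y. h y)"

(* arg_min chooses some minimizer; for proper convex lower semicontinuous g on a Euclidean
   space and \<alpha> > 0 the minimizer exists and is unique. *)
definition prox :: "real \<Rightarrow> ('a::real_normed_vector \<Rightarrow> ereal) \<Rightarrow> 'a \<Rightarrow> 'a" where
  "prox \<alpha> g z = arg_min (\<lambda>y. ereal \<alpha> * g y + ereal (1/2 * (norm (z - y))\<^sup>2)) (\<lambda>_. True)"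

(* The \<sigma>-algebra on space M generated by e 0, ..., e (k - 1), i.e. F_{k-1} in the usual
   indexing; it is the trivial \<sigma>-algebra for k = 0. *)
definition past_sigma :: "'w measure \<Rightarrow> (nat \<Rightarrow> 'w \<Rightarrow> 'a::topological_space) \<Rightarrow> nat \<Rightarrow> 'w measure" where
  "past_sigma M e k =
     sigma (space M) {e i -` A \<inter> space M | i A. i < k \<and> A \<in> sets borel}"

definition rate :: "real \<Rightarrow> real" where
  "rate \<tau> = 40 * \<tau>\<^sup>2 / (1 + 40 * \<tau>\<^sup>2)"

definition vartheta :: "real \<Rightarrow> real \<Rightarrow> real" where
  "vartheta L \<tau> = L * ((1 + 40 * \<tau>\<^sup>2) / (40 * \<tau>\<^sup>2))"

end

theory Submission
  imports Defs
begin

text \<open>Although \<open>f\<close> need not be convex, the two-sided quadratic bounds from its Lipschitz gradient, the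
  variational inequality for the prox and the error bound give the one-step contraction
  \<open>\<pi>\<^sub>k\<^sub>+\<^sub>1 \<le> \<rho> (\<pi>\<^sub>k + \<parallel>e\<^sub>k\<parallel>\<^sup>2 / L)\<close>. Since \<open>\<rho> / L = 1 / \<vartheta>\<close>, unrolling yields
  \<open>\<vartheta> (\<pi>\<^sub>k - \<rho>\<^sup>k \<pi>\<^sub>0) \<le> \<Sum>\<^sub>i\<^sub><\<^sub>k \<rho>\<^sup>k\<^sup>-\<^sup>i\<^sup>-\<^sup>1 \<parallel>e\<^sub>i\<parallel>\<^sup>2\<close>. The Chernoff bound, together with conditioning on the
  last error first, finishes the proof.\<close>

section \<open>Lower semicontinuity and lower bounds for convex functions\<close>

text \<open>\<open>Liminf (at y)\<close> only controls punctured neighbourhoods of \<open>y\<close>.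
  Any \<open>c < g y\<close> also holds at \<open>y\<close> itself, so it bounds \<open>g\<close> on
  a full neighbourhood, which a sequence hitting \<open>y\<close> requires.\<close>

lemma lsc_fun_le_limit:
  fixes g :: "'a::topological_space \<Rightarrow> ereal"
  assumes "lsc_fun g" "X \<longlonglongrightarrow> y" "(\<lambda>n. g (X n)) \<longlonglongrightarrow> l"
  shows "g y \<le> l"
proof (rule ccontr)
  assume "\<not> g y \<le> l"
  then obtain c where c: "l < c" "c < g y"
    using dense[of l "g y"] by (auto simp: not_le)
  then have "c < Liminf (at y) g"
    using assms(1) unfolding lsc_fun_def by (meson less_le_trans)
  then have "\<forall>\<^sub>F z in at y. c < g z" by (rule less_LiminfD)
  then have "\<forall>\<^sub>F z in nhds y. c < g z"
    using c unfolding eventually_at_filter by (auto elim: eventually_mono)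
  then have "\<forall>\<^sub>F n in sequentially. c < g (X n)"
    using assms(2) by (rule eventually_compose_filterlim)
  then have "c \<le> l"
    using assms(3) by (intro tendsto_lowerbound[of _ l sequentially c]) (auto elim: eventually_mono)
  with c show False by simp
qed

text \<open>Otherwise points with \<open>g (X n) < - n\<close> would accumulate at a point of value
  \<open>-\<infinity>\<close>, which properness excludes.\<close>

lemma lsc_fun_bounded_below_on_compact:
  fixes g :: "'a::metric_space \<Rightarrow> ereal"
  assumes lsc: "lsc_fun g" and "proper_fun g" and K: "compact K"
  obtains B :: real where "\<And>y. y \<in> K \<Longrightarrow> ereal B \<le> g y"
proof -
  have "\<exists>B::real. \<forall>y\<in>K. ereal B \<le> g y"
  proof (rule ccontr)
    assume "\<nexists>B::real. \<forall>y\<in>K. ereal B \<le> g y"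
    then have "\<forall>n::nat. \<exists>y\<in>K. g y < ereal (- real n)" by (meson not_le)
    then obtain X where X: "\<And>n. X n \<in> K" "\<And>n. g (X n) < ereal (- real n)" by metis
    obtain y r where r: "strict_mono (r :: nat \<Rightarrow> nat)" "(X \<circ> r) \<longlonglongrightarrow> y"
      using K X(1) unfolding compact_def by metis
    have "(\<lambda>n. g (X (r n))) \<longlonglongrightarrow> -\<infinity>"
      unfolding tendsto_MInfty
    proof
      fix c :: real
      have "\<forall>\<^sub>F n in sequentially. real n > - c"
        using filterlim_real_sequentially by (simp add: filterlim_at_top_dense)
      then show "\<forall>\<^sub>F n in sequentially. g (X (r n)) < ereal c"
      proof (rule eventually_mono)
        fix n assume "real n > - c"
        then have "ereal (- real (r n)) < ereal c" using seq_suble[OF r(1), of n] by simp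
        then show "g (X (r n)) < ereal c" using X(2)[of "r n"] by (rule less_trans[rotated])
      qed
    qed
    then have "g y \<le> -\<infinity>"
      using lsc_fun_le_limit[OF lsc r(2), of "-\<infinity>"] by (simp only: o_def)
    then show False using assms(2) by (auto simp: proper_fun_def)
  qed
  then show ?thesis using that by blast
qed

lemma proper_fun_ereal:
  assumes "proper_fun g" "g y < \<infinity>"
  shows "g y = ereal (real_of_ereal (g y))"
  using assms by (cases "g y") (auto simp: proper_fun_def)

text \<open>A convex function decreases at most linearly: compare a distant point with the unit
  ball around a fixed point of the domain.\<close>
lemma convex_fun_linear_lower_bound:
  fixes g :: "'a::euclidean_space \<Rightarrow> ereal"
  assumes p: "proper_fun g" and cvx: "convex_fun g" and lsc: "lsc_fun g" and a: "g a < \<infinity>"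
  obtains C :: real where "C \<ge> 0" "\<And>y. ereal (- C - C * norm (y - a)) \<le> g y"
proof -
  obtain B where B: "\<And>y. y \<in> cball a 1 \<Longrightarrow> ereal B \<le> g y"
    using lsc_fun_bounded_below_on_compact[OF lsc p compact_cball] by metis
  define A where "A = real_of_ereal (g a)"
  have gA: "g a = ereal A" unfolding A_def by (rule proper_fun_ereal[OF p a])
  \<comment> \<open>Large enough for three uses: \<open>- C \<le> B\<close> inside the unit ball,
    and \<open>A - B \<le> C\<close> and \<open>- C \<le> A\<close> outside it.\<close>
  define C where "C = \<bar>B\<bar> + \<bar>A\<bar>"
  show ?thesis
  proof (rule that[of C])
    show "C \<ge> 0" by (simp add: C_def)
    fix y
    show "ereal (- C - C * norm (y - a)) \<le> g y"
    proof (cases "norm (y - a) \<le> 1")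
      case True
      have "0 \<le> C * norm (y - a)" "- C \<le> B" by (auto simp: C_def)
      then have "ereal (- C - C * norm (y - a)) \<le> ereal B" by simp
      also have "\<dots> \<le> g y" using True by (intro B) (simp add: dist_norm norm_minus_commute)
      finally show ?thesis .
    next
      case False
      show ?thesis
      proof (cases "g y < \<infinity>")
        case True
        define b where "b = real_of_ereal (g y)"
        have gb: "g y = ereal b" unfolding b_def by (rule proper_fun_ereal[OF p True])
        define r where "r = norm (y - a)"
        have r: "r > 1" using False by (simp add: r_def)
        \<comment> \<open>The point where the segment from \<open>a\<close> to \<open>y\<close>
          leaves the unit ball. There \<open>g\<close> is at least \<open>B\<close>, and convexity
          turns this into a bound on \<open>g y\<close>.\<close>
        define w where "w = (1 - 1 / r) *\<^sub>R a + (1 / r) *\<^sub>R y"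
        have "w - a = (1 / r) *\<^sub>R (y - a)" by (simp add: w_def algebra_simps)
        moreover have "y \<noteq> a" using r by (auto simp: r_def)
        ultimately have "norm (w - a) = 1" by (simp add: r_def)
        then have "ereal B \<le> g w" by (intro B) (simp add: dist_norm norm_minus_commute)
        also have "\<dots> \<le> ereal (1 - 1 / r) * g a + ereal (1 / r) * g y"
        proof -
          have "1 / r \<in> {0<..<1}" using r by simp
          with cvx show ?thesis unfolding convex_fun_def w_def by blast
        qed
        finally have "B \<le> (1 - 1 / r) * A + (1 / r) * b" by (simp add: gA gb)
        then have "r * B \<le> r * ((1 - 1 / r) * A + (1 / r) * b)"
          using r by (intro mult_left_mono) auto
        also have "\<dots> = r * A - A + b" using r by (simp add: field_simps)
        finally have "r * B - r * A + A \<le> b" by simp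
        moreover have "- (C * r) \<le> r * B - r * A"
        proof -
          have "r * (- C) \<le> r * (B - A)" using r by (intro mult_left_mono) (auto simp: C_def)
          then show ?thesis by (simp add: algebra_simps)
        qed
        moreover have "- C \<le> A" by (auto simp: C_def)
        ultimately show ?thesis by (simp add: gb r_def)
      qed auto
    qed
  qed
qed

section \<open>The proximal map\<close>

text \<open>\<open>arg_min\<close> says something about \<open>prox\<close> only once a minimizer
  exists. The direct method supplies one: the linear lower bound on \<open>g\<close> loses against
  the quadratic term, so a minimizing sequence is bounded, and lower semicontinuity handles its
  limit.\<close>

lemma prox_is_arg_min:
  fixes g :: "'a::euclidean_space \<Rightarrow> ereal"
  assumes p: "proper_fun g" and cvx: "convex_fun g" and lsc: "lsc_fun g" and \<alpha>: "\<alpha> > 0"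
  shows "is_arg_min (\<lambda>y. ereal \<alpha> * g y + ereal (1/2 * (norm (z - y))\<^sup>2)) (\<lambda>_. True) (prox \<alpha> g z)"
proof -
  obtain a where a: "g a < \<infinity>" using p by (auto simp: proper_fun_def)
  obtain C where C: "C \<ge> 0" "\<And>y. ereal (- C - C * norm (y - a)) \<le> g y"
    using convex_fun_linear_lower_bound[OF p cvx lsc a] by metis
  let ?F = "\<lambda>y. ereal \<alpha> * g y + ereal (1/2 * (norm (z - y))\<^sup>2)"
  define D where "D = {y. g y < \<infinity>}"
  define G where "G y = real_of_ereal (g y)" for y
  define F where "F y = \<alpha> * G y + 1/2 * (norm (z - y))\<^sup>2" for y
  have gG: "g y = ereal (G y)" if "y \<in> D" for y
    unfolding G_def using that by (intro proper_fun_ereal[OF p]) (simp add: D_def)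
  have FF: "?F y = ereal (F y)" if "y \<in> D" for y using gG[OF that] by (simp add: F_def)
  \<comment> \<open>\<open>E\<close> and \<open>J\<close> are the slope and offset of the linear
    lower bound for \<alpha> \<open>g\<close>, after moving its centre from \<open>a\<close> to
    \<open>z\<close>.\<close>
  define E where "E = \<alpha> * C"
  define J where "J = E + E * norm (z - a)"
  have E0: "E \<ge> 0" "J \<ge> 0" using \<alpha> C(1) by (auto simp: E_def J_def)
  have lower: "(norm (z - y))\<^sup>2 / 2 - E * norm (z - y) - J \<le> F y" if "y \<in> D" for y
  proof -
    have "- C - C * norm (y - a) \<le> G y" using C(2)[of y] gG[OF that] by simp
    then have "\<alpha> * (- C - C * norm (y - a)) \<le> \<alpha> * G y" using \<alpha> by simp
    moreover have "norm (y - a) \<le> norm (z - y) + norm (z - a)"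
      by (metis add.commute diff_add_cancel norm_minus_commute norm_triangle_ineq4 add_diff_eq diff_diff_eq2)
    then have "E * norm (y - a) \<le> E * (norm (z - y) + norm (z - a))"
      using E0 by (intro mult_left_mono)
    ultimately show ?thesis by (simp add: F_def J_def E_def algebra_simps)
  qed
  have low: "- (E\<^sup>2 / 2) - J \<le> F y" if "y \<in> D" for y
  proof -
    \<comment> \<open>Completing the square minimizes the quadratic bound \<open>lower\<close> in
      \<open>norm (z - y)\<close>.\<close>
    have "0 \<le> (norm (z - y) - E)\<^sup>2" by simp
    then show ?thesis using lower[OF that] by (simp add: power2_eq_square algebra_simps)
  qed
  then have bdd: "bdd_below (F ` D)" by (auto intro!: bdd_belowI)
  have ne: "F ` D \<noteq> {}" using a by (auto simp: D_def)
  define m where "m = Inf (F ` D)"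
  have m: "m \<le> F y" if "y \<in> D" for y unfolding m_def using bdd that by (intro cInf_lower) auto
  have "\<exists>y\<in>D. F y < m + 1 / real (Suc n)" for n
    using cInf_lessD[OF ne, of "m + 1 / real (Suc n)"] unfolding m_def by auto
  then obtain X where X: "\<And>n. X n \<in> D" "\<And>n. F (X n) < m + 1 / real (Suc n)" by metis
  \<comment> \<open>For \<open>u > R\<close>, multiplying out \<open>u * u \<ge> R * u\<close> makes
    the bound \<open>lower\<close> exceed \<open>\<bar>m\<bar> + 1\<close>, which no
    \<open>F (X n)\<close> reaches.\<close>
  define R where "R = 1 + 2 * E + 2 * (\<bar>m\<bar> + 1 + J)"
  have "X n \<in> cball z R" for n
  proof (rule ccontr)
    assume "X n \<notin> cball z R"
    then have u: "norm (z - X n) > R" by (simp add: dist_norm)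
    define u where "u = norm (z - X n)"
    have "1 / real (Suc n) \<le> 1" by simp
    then have 1: "u\<^sup>2 / 2 - E * u - J < \<bar>m\<bar> + 1"
      using lower[OF X(1)[of n]] X(2)[of n] unfolding u_def by linarith
    have uR: "u > R" "u > 1" using u E0 by (auto simp: u_def R_def)
    then have "u * u \<ge> R * u" by (intro mult_right_mono) auto
    moreover have "(2 * (\<bar>m\<bar> + 1 + J)) * u \<ge> (2 * (\<bar>m\<bar> + 1 + J)) * 1"
      using uR E0 by (intro mult_left_mono) auto
    ultimately show False using 1 uR by (simp add: R_def power2_eq_square algebra_simps)
  qed
  then obtain y r where r: "strict_mono (r :: nat \<Rightarrow> nat)" "(X \<circ> r) \<longlonglongrightarrow> y"
    using compact_cball[of z R] unfolding compact_def by metis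
  have FX: "(\<lambda>n. F (X n)) \<longlonglongrightarrow> m"
  proof (rule tendsto_sandwich[of "\<lambda>_. m" _ _ "\<lambda>n. m + 1 / real (Suc n)"])
    show "(\<lambda>n. m + 1 / real (Suc n)) \<longlonglongrightarrow> m"
      using tendsto_add[OF tendsto_const LIMSEQ_inverse_real_of_nat, of m] by (simp add: inverse_eq_divide)
  qed (use m X in \<open>auto intro!: always_eventually less_imp_le\<close>)
  have FXr: "(\<lambda>n. F (X (r n))) \<longlonglongrightarrow> m"
    using LIMSEQ_subseq_LIMSEQ[OF FX r(1)] by (simp add: o_def)
  have Xr: "(\<lambda>n. X (r n)) \<longlonglongrightarrow> y" using r(2) by (simp add: o_def)
  \<comment> \<open>Solving \<open>F\<close> for \<open>G\<close> shows that the values of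
    \<open>g\<close> converge to \<open>l\<close>. Hence \<open>g y \<le> l\<close>, and this is
    \<open>F y \<le> m\<close> rearranged.\<close>
  define l where "l = (m - 1/2 * (norm (z - y))\<^sup>2) / \<alpha>"
  have "(\<lambda>n. (F (X (r n)) - 1/2 * (norm (z - X (r n)))\<^sup>2) / \<alpha>) \<longlonglongrightarrow> l"
    unfolding l_def using \<alpha> by (intro tendsto_intros FXr Xr) auto
  then have "(\<lambda>n. G (X (r n))) \<longlonglongrightarrow> l" using \<alpha> by (simp add: F_def)
  then have "(\<lambda>n. g (X (r n))) \<longlonglongrightarrow> ereal l" using gG[OF X(1)] by simp
  then have gy: "g y \<le> ereal l" using lsc_fun_le_limit[OF lsc Xr] by simp
  then have yD: "y \<in> D" by (auto simp: D_def)
  have "F y \<le> m" using gy gG[OF yD] \<alpha> by (simp add: F_def l_def field_simps)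
  have "is_arg_min ?F (\<lambda>_. True) y"
    unfolding is_arg_min_linorder
  proof (intro conjI allI impI TrueI)
    fix w
    show "?F y \<le> ?F w"
    proof (cases "w \<in> D")
      case True
      then show ?thesis using m[OF True] \<open>F y \<le> m\<close> unfolding FF[OF True] FF[OF yD] by simp
    next
      case False
      then have "g w = \<infinity>" by (simp add: D_def)
      then have "?F w = \<infinity>" using \<alpha> by simp
      then show ?thesis by (simp only: ereal_less_eq)
    qed
  qed
  then show ?thesis unfolding prox_def arg_min_def by (rule someI)
qed

text \<open>First-order optimality without derivatives of \<open>g\<close>: compare the proximal
  point with points at fraction \<open>t\<close> of the segment to \<open>y\<close>, use convexity,
  divide by \<open>t\<close> and let \<open>t\<close> tend to 0.\<close>

lemma prox_variational_inequality:
  fixes g :: "'a::euclidean_space \<Rightarrow> ereal"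
  assumes p: "proper_fun g" and cvx: "convex_fun g" and lsc: "lsc_fun g" and \<alpha>: "\<alpha> > 0"
    and y: "g y < \<infinity>"
  shows "g (prox \<alpha> g z) < \<infinity>"
    and "inner (z - prox \<alpha> g z) (y - prox \<alpha> g z)
         \<le> \<alpha> * (real_of_ereal (g y) - real_of_ereal (g (prox \<alpha> g z)))"
proof -
  define q where "q = prox \<alpha> g z"
  define b where "b = real_of_ereal (g y)"
  have gb: "g y = ereal b" unfolding b_def by (rule proper_fun_ereal[OF p y])
  have min: "ereal \<alpha> * g q + ereal (1/2 * (norm (z - q))\<^sup>2)
             \<le> ereal \<alpha> * g w + ereal (1/2 * (norm (z - w))\<^sup>2)" for w
    using prox_is_arg_min[OF p cvx lsc \<alpha>, of z] unfolding is_arg_min_linorder q_def by blast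
  have q: "g q < \<infinity>" using min[of y] \<alpha> by (cases "g q") (auto simp: gb)
  then show "g (prox \<alpha> g z) < \<infinity>" by (simp add: q_def)
  define c where "c = real_of_ereal (g q)"
  have gc: "g q = ereal c" unfolding c_def by (rule proper_fun_ereal[OF p q])
  have ineq: "inner (z - q) (y - q) \<le> \<alpha> * (b - c) + t * ((norm (y - q))\<^sup>2 / 2)"
    if t: "0 < t" "t < 1" for t
  proof -
    define w where "w = (1 - t) *\<^sub>R q + t *\<^sub>R y"
    have "g w \<le> ereal (1 - t) * g q + ereal t * g y"
      using cvx t unfolding convex_fun_def w_def by auto
    then have gw: "g w \<le> ereal ((1 - t) * c + t * b)" by (simp add: gb gc)
    have "ereal (\<alpha> * c + 1/2 * (norm (z - q))\<^sup>2) \<le> ereal \<alpha> * g w + ereal (1/2 * (norm (z - w))\<^sup>2)"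
      using min[of w] by (simp add: gc)
    also have "\<dots> \<le> ereal \<alpha> * ereal ((1 - t) * c + t * b) + ereal (1/2 * (norm (z - w))\<^sup>2)"
      using \<alpha> gw by (intro add_right_mono ereal_mult_left_mono) auto
    finally have "\<alpha> * c + 1/2 * (norm (z - q))\<^sup>2 \<le> \<alpha> * ((1 - t) * c + t * b) + 1/2 * (norm (z - w))\<^sup>2"
      by simp
    moreover have "z - w = (z - q) - t *\<^sub>R (y - q)" by (simp add: w_def algebra_simps)
    then have "(norm (z - w))\<^sup>2 = (norm (z - q))\<^sup>2 - 2 * t * inner (z - q) (y - q) + t\<^sup>2 * (norm (y - q))\<^sup>2"
      using dot_norm_neg[of "z - q" "t *\<^sub>R (y - q)"] by (simp only:) (simp add: power_mult_distrib)
    ultimately have "t * inner (z - q) (y - q) \<le> t * (\<alpha> * (b - c) + t * ((norm (y - q))\<^sup>2 / 2))"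
      by (simp add: algebra_simps power2_eq_square)
    then show ?thesis using t by simp
  qed
  have "((\<lambda>t. \<alpha> * (b - c) + t * ((norm (y - q))\<^sup>2 / 2)) \<longlongrightarrow> \<alpha> * (b - c) + 0 * ((norm (y - q))\<^sup>2 / 2))
          (at_right (0::real))"
    by (intro tendsto_intros)
  moreover have "\<forall>\<^sub>F t in at_right (0::real). inner (z - q) (y - q) \<le> \<alpha> * (b - c) + t * ((norm (y - q))\<^sup>2 / 2)"
    using eventually_at_right_real[OF zero_less_one] by (rule eventually_mono) (rule ineq, simp_all)
  ultimately have "inner (z - q) (y - q) \<le> \<alpha> * (b - c) + 0 * ((norm (y - q))\<^sup>2 / 2)"
    by (rule tendsto_lowerbound) simp
  then show "inner (z - prox \<alpha> g z) (y - prox \<alpha> g z)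
         \<le> \<alpha> * (real_of_ereal (g y) - real_of_ereal (g (prox \<alpha> g z)))"
    by (simp add: q_def b_def c_def)
qed

text \<open>Test the variational inequality of each proximal point against the other. In the sum the
  values of \<open>g\<close> cancel, and Cauchy-Schwarz finishes.\<close>

lemma prox_nonexpansive:
  fixes g :: "'a::euclidean_space \<Rightarrow> ereal"
  assumes p: "proper_fun g" and cvx: "convex_fun g" and lsc: "lsc_fun g" and \<alpha>: "\<alpha> > 0"
  shows "norm (prox \<alpha> g w - prox \<alpha> g z) \<le> norm (w - z)"
proof -
  define P Q where "P = prox \<alpha> g w" and "Q = prox \<alpha> g z"
  obtain a where a: "g a < \<infinity>" using p by (auto simp: proper_fun_def)
  note vi = prox_variational_inequality[OF p cvx lsc \<alpha>]
  have "g P < \<infinity>" "g Q < \<infinity>" unfolding P_def Q_def using vi(1)[OF a] by blast+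
  then have "inner (w - P) (Q - P) + inner (z - Q) (P - Q) \<le> 0"
    using vi(2)[of Q w] vi(2)[of P z] unfolding P_def Q_def by (simp add: algebra_simps)
  then have "inner (P - Q) (P - Q) \<le> inner (w - z) (P - Q)"
    by (simp add: inner_diff_left inner_diff_right inner_commute)
  also have "\<dots> \<le> norm (w - z) * norm (P - Q)" by (rule norm_cauchy_schwarz)
  finally have "norm (P - Q) * norm (P - Q) \<le> norm (w - z) * norm (P - Q)"
    by (simp flip: power2_norm_eq_inner power2_eq_square)
  then have "norm (P - Q) \<le> norm (w - z)"
    by (metis mult_right_le_imp_le norm_ge_zero order_le_less)
  then show ?thesis by (simp add: P_def Q_def)
qed

section \<open>Quadratic bounds from a Lipschitz gradient\<close>

lemma descent_lemma:
  fixes f :: "'a::real_inner \<Rightarrow> real"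
  assumes D: "\<And>y. GDERIV f y :> G y"
    and lip: "\<And>y z. norm (G z - G y) \<le> L * norm (z - y)"
  shows "f y \<le> f x + inner (G x) (y - x) + L / 2 * (norm (y - x))\<^sup>2"
proof -
  define d where "d = y - x"
  \<comment> \<open>The claim is \<open>\<phi> 1 \<le> \<phi> 0\<close>. The Lipschitz bound makes
    the derivative of \<open>\<phi>\<close> nonpositive on the unit interval.\<close>
  define \<phi> where "\<phi> t = f (x + t *\<^sub>R d) - t * inner (G x) d - L / 2 * t\<^sup>2 * (norm d)\<^sup>2" for t
  have "\<phi> 1 \<le> \<phi> 0"
  proof (rule DERIV_nonpos_imp_nonincreasing[where f = \<phi>])
    fix t :: real assume t: "0 \<le> t" "t \<le> 1"
    have f': "(f has_derivative (\<lambda>h. inner h (G (x + t *\<^sub>R d)))) (at (x + t *\<^sub>R d))"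
      using D unfolding gderiv_def .
    have "((\<lambda>t. f (x + t *\<^sub>R d)) has_derivative (\<lambda>s. inner (s *\<^sub>R d) (G (x + t *\<^sub>R d)))) (at t)"
      by (rule has_derivative_compose[where f = "\<lambda>t. x + t *\<^sub>R d" and g = f, OF _ f']) (auto intro!: derivative_eq_intros)
    then have "((\<lambda>t. f (x + t *\<^sub>R d)) has_real_derivative inner d (G (x + t *\<^sub>R d))) (at t)"
      unfolding has_field_derivative_def by (simp add: mult.commute[of "inner _ _"] fun_eq_iff mult_commute_abs)
    then have "(\<phi> has_real_derivative inner d (G (x + t *\<^sub>R d)) - inner (G x) d - L * t * (norm d)\<^sup>2) (at t)"
      unfolding \<phi>_def by (auto intro!: derivative_eq_intros)
    moreover have "inner d (G (x + t *\<^sub>R d)) - inner (G x) d - L * t * (norm d)\<^sup>2 \<le> 0"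
    proof -
      have "inner d (G (x + t *\<^sub>R d)) - inner (G x) d = inner (G (x + t *\<^sub>R d) - G x) d"
        by (simp add: inner_diff_left inner_commute[of d])
      also have "\<dots> \<le> norm (G (x + t *\<^sub>R d) - G x) * norm d" by (rule norm_cauchy_schwarz)
      also have "\<dots> \<le> (L * norm (t *\<^sub>R d)) * norm d"
        using lip[where y = x and z = "x + t *\<^sub>R d"] by (intro mult_right_mono) auto
      finally show ?thesis using t by (simp add: power2_eq_square)
    qed
    ultimately show "\<exists>y. (\<phi> has_real_derivative y) (at t) \<and> y \<le> 0" by blast
  qed simp
  then show ?thesis by (simp add: \<phi>_def d_def)
qed

text \<open>The upper bound applied to \<open>- f\<close>, whose gradient has the same Lipschitz
  constant.\<close>

lemma descent_lemma_lower:
  fixes f :: "'a::real_inner \<Rightarrow> real"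
  assumes D: "\<And>y. GDERIV f y :> G y"
    and lip: "\<And>y z. norm (G z - G y) \<le> L * norm (z - y)"
  shows "f x + inner (G x) (y - x) - L / 2 * (norm (y - x))\<^sup>2 \<le> f y"
proof -
  have "GDERIV (\<lambda>y. - f y) y :> - G y" for y by (rule GDERIV_minus[OF D])
  moreover have "norm (- G z - - G y) \<le> L * norm (z - y)" for y z
    using lip[of z y] by (metis minus_diff_minus norm_minus_cancel)
  ultimately have "- f y \<le> - f x + inner (- G x) (y - x) + L / 2 * (norm (y - x))\<^sup>2"
    by (rule descent_lemma)
  then show ?thesis by simp
qed

section \<open>One-step contraction of the optimality gap\<close>

lemma infdist_lessE:
  assumes "A \<noteq> {}" "infdist x A < r"
  obtains a where "a \<in> A" "dist x a < r"
  using assms cINF_less_iff[of A "dist x" r] by (auto simp: infdist_def)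

text \<open>With \<open>D = H x - H x\<^sub>+ + \<parallel>e\<parallel>\<^sup>2/L\<close>, comparing with \<open>x\<close> in the prox inequality bounds \<open>D\<close> below
  by a positive definite form in \<open>\<parallel>x\<^sub>+ - x\<parallel>\<close> and \<open>\<parallel>e\<parallel>\<close>, and comparing with a nearby minimizer bounds
  the new gap above by \<open>40 \<tau>\<^sup>2 D\<close>.\<close>
lemma inexact_prox_gradient_step:
  fixes f :: "'a::euclidean_space \<Rightarrow> real" and g h :: "'a \<Rightarrow> ereal" and x e :: 'a
  assumes f_diff: "\<And>y. GDERIV f y :> grad_f y"
    and p: "proper_fun g" and cvx: "convex_fun g" and lsc: "lsc_fun g"
    and h_eq: "h = (\<lambda>y. ereal (f y) + g y)"
    and L: "L > 0" and \<tau>: "\<tau> \<ge> 1"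
    and lip: "\<And>y z. norm (grad_f z - grad_f y) \<le> L * norm (z - y)"
    and error_bound: "\<And>y. infdist y (argmin_set h)
                        \<le> \<tau> * norm (y - prox (1 / L) g (y - (1 / L) *\<^sub>R grad_f y))"
    and s: "s \<in> argmin_set h" and x: "g x < \<infinity>"
  defines "H \<equiv> \<lambda>y. f y + real_of_ereal (g y)"
    and "x' \<equiv> prox (1 / L) g (x - (1 / L) *\<^sub>R (grad_f x + e))"
  shows "H x' - H s \<le> rate \<tau> * (H x - H s + (norm e)\<^sup>2 / L)"
proof -
  define G where "G y = real_of_ereal (g y)" for y
  have H: "H y = f y + G y" for y by (simp add: H_def G_def)
  have L': "1 / L > 0" using L by simp
  define d where "d = x' - x"
  define n where "n = norm d"
  \<comment> \<open>With this scaling \<open>L\<close> is a common factor of all quadratic terms in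
    \<open>n\<close> and \<open>m\<close>.\<close>
  define m where "m = norm e / L"
  have e: "norm e = L * m" using L by (simp add: m_def)
  have argmin: "h s' \<le> h y" if "s' \<in> argmin_set h" for s' y
    using that by (auto simp: argmin_set_def is_arg_min_linorder)
  have fin: "g s' < \<infinity>" if "s' \<in> argmin_set h" for s'
    using argmin[OF that, of x] x by (auto simp: h_eq)
  have hH: "h y = ereal (H y)" if "g y < \<infinity>" for y
    using proper_fun_ereal[OF p that] by (simp add: h_eq H G_def flip: plus_ereal.simps)
  \<comment> \<open>Lets the comparison minimizer \<open>s'\<close> vary while the gap stays
    measured at the fixed \<open>s\<close>.\<close>
  have Hs: "H s' = H s" if "s' \<in> argmin_set h" for s'
    using argmin[OF that, of s] argmin[OF s, of s'] hH[OF fin[OF that]] hH[OF fin[OF s]] by simp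
  have vi: "L * inner (x - x') (y - x') - inner (grad_f x + e) (y - x') \<le> G y - G x'"
    if "g y < \<infinity>" for y
  proof -
    have "inner (x - (1 / L) *\<^sub>R (grad_f x + e) - x') (y - x') \<le> 1 / L * (G y - G x')"
      unfolding G_def x'_def by (rule prox_variational_inequality(2)[OF p cvx lsc L' that])
    then have "L * inner (x - (1 / L) *\<^sub>R (grad_f x + e) - x') (y - x') \<le> G y - G x'"
      using L by (simp add: field_simps)
    moreover have "L * inner (x - (1 / L) *\<^sub>R (grad_f x + e) - x') (y - x')
        = L * inner (x - x') (y - x') - inner (grad_f x + e) (y - x')"
      using L by (simp add: inner_diff_left inner_add_left algebra_simps)
    ultimately show ?thesis by simp
  qed
  \<comment> \<open>The prox inequality against \<open>x\<close> gains \<open>L * n^2\<close>, the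
    descent lemma costs half of it, and the error contributes the cross term.\<close>
  have decrease: "H x' \<le> H x - L / 2 * n\<^sup>2 + L * m * n"
  proof -
    have "inner (x - x') (x - x') = n\<^sup>2"
      by (simp add: n_def d_def power2_norm_eq_inner[symmetric] norm_minus_commute)
    moreover have "inner (grad_f x + e) (x - x') = - inner (grad_f x + e) d"
      by (simp add: d_def inner_diff_right)
    ultimately have "L * n\<^sup>2 + inner (grad_f x + e) d \<le> G x - G x'"
      using vi[OF x] by simp
    moreover have "f x' \<le> f x + inner (grad_f x) d + L / 2 * n\<^sup>2"
      unfolding n_def d_def by (rule descent_lemma[OF f_diff lip])
    moreover have "- inner e d \<le> norm e * n"
      using Cauchy_Schwarz_ineq2[of e d] by (simp add: n_def)
    ultimately show ?thesis by (simp add: H e inner_add_left)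
  qed
  \<comment> \<open>Bounding \<open>f\<close> above at \<open>x'\<close> and below at
    \<open>s'\<close>, both around \<open>x\<close>, replaces convexity of \<open>f\<close>. The
    \<open>n\<close> terms cancel, and the term in \<open>r^2\<close> from polarization absorbs the
    error via Young's inequality.\<close>
  have gap_le: "H x' - H s \<le> L * m\<^sup>2 / 2 + L * (norm (x - s'))\<^sup>2" if s': "s' \<in> argmin_set h" for s'
  proof -
    define r where "r = norm (s' - x')"
    have "L * inner (x - x') (s' - x') - inner (grad_f x + e) (s' - x') \<le> G s' - G x'"
      by (rule vi[OF fin[OF s']])
    moreover have "inner (x - x') (s' - x') = (n\<^sup>2 + r\<^sup>2 - (norm (x - s'))\<^sup>2) / 2"
      unfolding n_def r_def d_def power2_norm_eq_inner
      by (simp add: inner_diff_left inner_diff_right inner_commute)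
    then have "L * inner (x - x') (s' - x') = L / 2 * n\<^sup>2 + L / 2 * r\<^sup>2 - L / 2 * (norm (x - s'))\<^sup>2"
      by (simp only:) (simp add: algebra_simps add_divide_distrib diff_divide_distrib)
    moreover have "f x' \<le> f x + inner (grad_f x) (x' - x) + L / 2 * n\<^sup>2"
      unfolding n_def d_def by (rule descent_lemma[OF f_diff lip])
    moreover have "f x + inner (grad_f x) (s' - x) - L / 2 * (norm (x - s'))\<^sup>2 \<le> f s'"
      unfolding norm_minus_commute[of x] by (rule descent_lemma_lower[OF f_diff lip])
    moreover have "inner e (s' - x') \<le> L * m * r"
      using norm_cauchy_schwarz[of e "s' - x'"] by (simp add: r_def e)
    moreover have "L * m * r \<le> L / 2 * r\<^sup>2 + L * m\<^sup>2 / 2"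
    proof -
      have "0 \<le> L * (r - m)\<^sup>2" using L by simp
      then show ?thesis by (simp add: power2_eq_square algebra_simps)
    qed
    ultimately show ?thesis
      unfolding Hs[OF s', symmetric] unfolding H by (simp add: inner_add_left inner_diff_right)
  qed
  define T where "T = \<tau> * (n + m)"
  \<comment> \<open>The error bound concerns the exact proximal step \<open>?q\<close>. By
    nonexpansiveness \<open>x'\<close> is within \<open>m\<close> of \<open>?q\<close>.\<close>
  have dist_le: "infdist x (argmin_set h) \<le> T"
  proof -
    let ?q = "prox (1 / L) g (x - (1 / L) *\<^sub>R grad_f x)"
    have "norm (x' - ?q) \<le> norm ((x - (1 / L) *\<^sub>R (grad_f x + e)) - (x - (1 / L) *\<^sub>R grad_f x))"
      unfolding x'_def by (rule prox_nonexpansive[OF p cvx lsc L'])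
    also have "\<dots> = norm (- ((1 / L) *\<^sub>R e))" by (simp add: algebra_simps)
    also have "\<dots> = m" using L by (simp add: m_def)
    finally have "norm (x - ?q) \<le> n + m"
      using norm_triangle_ineq[of "x - x'" "x' - ?q"] by (simp add: n_def d_def norm_minus_commute)
    then have "\<tau> * norm (x - ?q) \<le> T" using \<tau> by (simp add: T_def)
    then show ?thesis using error_bound[of x] by simp
  qed
  \<comment> \<open>Instead of a nearest minimizer, take one at distance less than \<open>t\<close>
    for each \<open>t > T\<close>, then let \<open>t\<close> decrease to \<open>T\<close>.\<close>
  have gap: "H x' - H s \<le> L * m\<^sup>2 / 2 + L * T\<^sup>2"
  proof (rule tendsto_lowerbound)
    show "((\<lambda>t. L * m\<^sup>2 / 2 + L * t\<^sup>2) \<longlongrightarrow> L * m\<^sup>2 / 2 + L * T\<^sup>2) (at_right T)"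
      by (intro tendsto_intros)
    show "\<forall>\<^sub>F t in at_right T. H x' - H s \<le> L * m\<^sup>2 / 2 + L * t\<^sup>2"
      unfolding eventually_at_right_field
    proof (intro exI[of _ "T + 1"] conjI allI impI)
      fix t assume t: "T < t"
      then obtain s' where s': "s' \<in> argmin_set h" "dist x s' < t"
        using infdist_lessE[of "argmin_set h" x t] s le_less_trans[OF dist_le t] by blast
      have "(norm (x - s'))\<^sup>2 \<le> t\<^sup>2" using s'(2) by (intro power_mono) (auto simp: dist_norm)
      then have "L * (norm (x - s'))\<^sup>2 \<le> L * t\<^sup>2" using L by simp
      then show "H x' - H s \<le> L * m\<^sup>2 / 2 + L * t\<^sup>2" using gap_le[OF s'(1)] by simp
    qed simp
  qed simp
  define c where "c = 40 * \<tau>\<^sup>2"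
  define D where "D = H x - H x' + L * m\<^sup>2"
  have c: "c > 0" using \<tau> by (simp add: c_def)
  have quad: "m\<^sup>2 / 2 + T\<^sup>2 \<le> c * (n\<^sup>2 / 2 - m * n + m\<^sup>2)"
  proof -
    \<comment> \<open>Inserting \<open>T\<close> and \<open>c\<close> reduces the claim to
      \<open>m^2 / 2 \<le> \<tau>^2 * ?Q\<close>, with coefficients 20 - 1, -40 - 2 and 40 - 1.
      Since \<tau> is at least 1, the case \<tau> = 1 suffices, and this is its completed
      square.\<close>
    have "0 \<le> ((19 * n - 21 * m)\<^sup>2 + 581 / 2 * m\<^sup>2) / 19" by simp
    then have q: "m\<^sup>2 / 2 \<le> 19 * n\<^sup>2 - 42 * (m * n) + 39 * m\<^sup>2" (is "_ \<le> ?Q")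
      by (simp add: power2_eq_square algebra_simps)
    moreover have "0 \<le> m\<^sup>2 / 2" by simp
    ultimately have "0 \<le> ?Q" by linarith
    then have "1 * ?Q \<le> \<tau>\<^sup>2 * ?Q" using \<tau> by (intro mult_right_mono) auto
    then have "m\<^sup>2 / 2 \<le> \<tau>\<^sup>2 * ?Q" using q by simp
    then show ?thesis by (simp add: T_def c_def power2_eq_square algebra_simps)
  qed
  have "H x' - H s \<le> L * (m\<^sup>2 / 2 + T\<^sup>2)" using gap by (simp add: algebra_simps)
  also have "\<dots> \<le> L * (c * (n\<^sup>2 / 2 - m * n + m\<^sup>2))" using L quad by simp
  also have "\<dots> = c * (L / 2 * n\<^sup>2 - L * m * n + L * m\<^sup>2)" by (simp add: algebra_simps)
  also have "\<dots> \<le> c * D" using decrease c by (intro mult_left_mono) (auto simp: D_def)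
  \<comment> \<open>\<open>D\<close> contains \<open>- H x'\<close>; moving \<open>c\<close> times
    the new gap to the left creates the factor \<open>1 + c\<close>, hence the rate
    \<open>c / (1 + c)\<close>.\<close>
  finally have "(1 + c) * (H x' - H s) \<le> c * (H x - H s + L * m\<^sup>2)"
    by (simp add: D_def algebra_simps)
  then have "H x' - H s \<le> c / (1 + c) * (H x - H s + L * m\<^sup>2)"
    using c by (simp add: field_simps)
  moreover have "L * m\<^sup>2 = (norm e)\<^sup>2 / L" using L by (simp add: m_def power2_eq_square)
  ultimately show ?thesis by (simp add: rate_def c_def)
qed

section \<open>Conditioning on the past errors\<close>

lemma space_past_sigma [simp]: "space (past_sigma M e k) = space M"
  unfolding past_sigma_def by (intro space_measure_of) auto

lemma sets_past_sigma:
  "sets (past_sigma M e k) =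
     sigma_sets (space M) {e i -` A \<inter> space M | i A. i < k \<and> A \<in> sets borel}"
  unfolding past_sigma_def by (intro sets_measure_of) auto

lemma measurable_past_sigma:
  assumes "i < k" shows "e i \<in> borel_measurable (past_sigma M e k)"
  using assms by (intro measurableI) (auto simp: sets_past_sigma)

lemma subalgebra_past_sigma:
  assumes "\<And>i. e i \<in> borel_measurable M"
  shows "subalgebra M (past_sigma M e k)"
  unfolding subalgebra_def sets_past_sigma
  using measurable_sets[OF assms] by (auto intro!: sets.sigma_sets_subset)

text \<open>The first \<open>k\<close> factors depend only on \<open>e 0\<close>, ...,
  \<open>e (k - 1)\<close>, so they pass through the conditional expectation given
  \<open>past_sigma M e k\<close>. The bound on the remaining factor is deterministic and leaves the
  integral, and no independence of the errors enters.\<close>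

lemma nn_integral_exp_sum_norm_le:
  fixes e :: "nat \<Rightarrow> 'w \<Rightarrow> 'a::euclidean_space" and \<gamma> :: "nat \<Rightarrow> real \<Rightarrow> ennreal"
  assumes prob: "prob_space M"
    and e_random [measurable]: "\<And>i. e i \<in> borel_measurable M"
    and mgf_bound: "\<And>i \<theta>. \<theta> \<ge> 0 \<Longrightarrow>
          (AE \<omega> in M. nn_cond_exp M (past_sigma M e i)
                         (\<lambda>\<omega>'. ennreal (exp (\<theta> * (norm (e i \<omega>'))\<^sup>2))) \<omega> \<le> \<gamma> i \<theta>)"
    and a: "\<And>i. a i \<ge> 0"
  shows "(\<integral>\<^sup>+\<omega>. ennreal (exp (\<Sum>i<k. a i * (norm (e i \<omega>))\<^sup>2)) \<partial>M) \<le> (\<Prod>i<k. \<gamma> i (a i))"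
proof (induction k)
  case 0
  then show ?case using prob_space.emeasure_space_1[OF prob] by simp
next
  case (Suc k)
  let ?F = "past_sigma M e k"
  define P where "P \<omega> = ennreal (exp (\<Sum>i<k. a i * (norm (e i \<omega>))\<^sup>2))" for \<omega>
  define Y where "Y \<omega> = ennreal (exp (a k * (norm (e k \<omega>))\<^sup>2))" for \<omega>
  have "(\<lambda>\<omega>. \<Sum>i<k. a i * (norm (e i \<omega>))\<^sup>2) \<in> borel_measurable ?F"
    by (intro borel_measurable_sum borel_measurable_times borel_measurable_const
        borel_measurable_power measurable_compose[OF measurable_past_sigma borel_measurable_norm]) simp
  then have P: "P \<in> borel_measurable ?F" unfolding P_def by measurable
  have PM [measurable]: "P \<in> borel_measurable M" unfolding P_def by measurable
  have Y: "Y \<in> borel_measurable M" unfolding Y_def by measurable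
  interpret prob_space M by (rule prob)
  interpret finite_measure_subalgebra M ?F
    by unfold_locales (rule subalgebra_past_sigma[OF e_random])
  have "(\<integral>\<^sup>+\<omega>. ennreal (exp (\<Sum>i<Suc k. a i * (norm (e i \<omega>))\<^sup>2)) \<partial>M) = (\<integral>\<^sup>+\<omega>. P \<omega> * Y \<omega> \<partial>M)"
    by (simp add: P_def Y_def exp_add ennreal_mult)
  also have "\<dots> = (\<integral>\<^sup>+\<omega>. P \<omega> * nn_cond_exp M ?F Y \<omega> \<partial>M)"
    by (rule nn_cond_exp_intg[OF P Y, symmetric])
  also have "\<dots> \<le> (\<integral>\<^sup>+\<omega>. P \<omega> * \<gamma> k (a k) \<partial>M)"
    using mgf_bound[OF a, of k k] unfolding Y_def[symmetric]
    by (intro nn_integral_mono_AE) (auto elim!: eventually_mono intro: mult_left_mono)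
  also have "\<dots> = (\<integral>\<^sup>+\<omega>. P \<omega> \<partial>M) * \<gamma> k (a k)" by (rule nn_integral_multc) simp
  also have "\<dots> \<le> (\<Prod>i<k. \<gamma> i (a i)) * \<gamma> k (a k)"
    using Suc.IH unfolding P_def by (rule mult_right_mono) simp
  finally show ?case by simp
qed

section \<open>The tail bound\<close>

theorem theorem3p5:
  fixes f :: "real ^ 'n \<Rightarrow> real"
    and grad_f :: "real ^ 'n \<Rightarrow> real ^ 'n"
    and g h :: "real ^ 'n \<Rightarrow> ereal"
    and L \<tau> \<sigma> \<epsilon> :: real
    and M :: "'w measure"
    and e x :: "nat \<Rightarrow> 'w \<Rightarrow> real ^ 'n"
    and x0 :: "real ^ 'n"
    and \<gamma> :: "nat \<Rightarrow> real \<Rightarrow> ennreal"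
    and k :: nat
  assumes f_diff: "\<And>y. GDERIV f y :> grad_f y"
    and g_proper: "proper_fun g"
    and g_convex: "convex_fun g"
    and g_lsc: "lsc_fun g"
    and h_eq: "h = (\<lambda>y. ereal (f y) + g y)"
    and sol_nonempty: "argmin_set h \<noteq> {}"
    and L_pos: "L > 0"
    and tau_ge_1: "\<tau> \<ge> 1"
    and grad_lipschitz: "\<And>y z. norm (grad_f z - grad_f y) \<le> L * norm (z - y)"
    and error_bound: "\<And>y. infdist y (argmin_set h)
                        \<le> \<tau> * norm (y - prox (1 / L) g (y - (1 / L) *\<^sub>R grad_f y))"
    and prob: "prob_space M"
    and e_random: "\<And>i. e i \<in> borel_measurable M"
    and x0_dom: "x0 \<in> effective_domain g"
    and x_0: "\<And>\<omega>. \<omega> \<in> space M \<Longrightarrow> x 0 \<omega> = x0"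
    and x_Suc: "\<And>i \<omega>. \<omega> \<in> space M \<Longrightarrow>
                  x (Suc i) \<omega> = prox (1 / L) g (x i \<omega> - (1 / L) *\<^sub>R (grad_f (x i \<omega>) + e i \<omega>))"
    and sigma_pos: "\<sigma> > 0"
    and mgf_finite: "\<And>i \<theta>. \<theta> \<in> {0..<\<sigma>} \<Longrightarrow>
          (AE \<omega> in M. nn_cond_exp M (past_sigma M e i)
                         (\<lambda>\<omega>'. ennreal (exp (\<theta> * (norm (e i \<omega>'))\<^sup>2))) \<omega> < \<infinity>)"
    and gamma_0: "\<And>i. \<gamma> i 0 = 1"
    and mgf_bound: "\<And>i \<theta>. \<theta> \<ge> 0 \<Longrightarrow>
          (AE \<omega> in M. nn_cond_exp M (past_sigma M e i)
                         (\<lambda>\<omega>'. ennreal (exp (\<theta> * (norm (e i \<omega>'))\<^sup>2))) \<omega> \<le> \<gamma> i \<theta>)"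
    and k_ge_1: "k \<ge> 1"
    and eps_pos: "\<epsilon> > 0"
  shows "emeasure M {\<omega> \<in> space M. opt_gap h (x k \<omega>) - ereal (rate \<tau> ^ k) * opt_gap h (x 0 \<omega>) \<ge> ereal \<epsilon>}
         \<le> (INF \<theta>\<in>{0<..}. ennreal (exp (- \<theta> * vartheta L \<tau> * \<epsilon>)) *
                             (\<Prod>i<k. \<gamma> i (\<theta> * rate \<tau> ^ (k - i - 1))))"
proof (rule INF_greatest)
  fix \<theta> :: real assume "\<theta> \<in> {0<..}"
  then have \<theta>: "\<theta> > 0" by simp
  obtain s where s: "s \<in> argmin_set h" using sol_nonempty by auto
  define H where "H y = f y + real_of_ereal (g y)" for y
  define \<rho> where "\<rho> = rate \<tau>"
  define S where "S j \<omega> = (\<Sum>i<j. \<rho> ^ (j - i - 1) * (norm (e i \<omega>))\<^sup>2)" for j \<omega>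
  have \<rho>: "\<rho> > 0" using tau_ge_1 by (auto simp: \<rho>_def rate_def intro!: divide_pos_pos add_pos_nonneg)
  have v: "vartheta L \<tau> > 0"
    using tau_ge_1 L_pos by (auto simp: vartheta_def intro!: mult_pos_pos divide_pos_pos add_pos_nonneg)
  have \<rho>v: "\<rho> / L = 1 / vartheta L \<tau>" by (simp add: \<rho>_def rate_def vartheta_def)
  have s_min: "h s \<le> h y" for y using s by (auto simp: argmin_set_def is_arg_min_linorder)
  have gx0: "g x0 < \<infinity>" using x0_dom by (simp add: effective_domain_def)
  have gs: "g s < \<infinity>" using s_min[of x0] gx0 by (auto simp: h_eq)
  have hH: "h y = ereal (H y)" if "g y < \<infinity>" for y
    using proper_fun_ereal[OF g_proper that] by (simp add: h_eq H_def flip: plus_ereal.simps)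
  have "(INF y. h y) = h s" by (intro antisym INF_lower INF_greatest s_min) simp
  then have gap: "opt_gap h y = ereal (H y - H s)" if "g y < \<infinity>" for y
    using hH[OF that] hH[OF gs] by (simp add: opt_gap_def)
  \<comment> \<open>The start lies in the domain, and every later iterate is a proximal point. All
    gaps are thus real, and \<open>ereal\<close> subtraction is harmless.\<close>
  have dom: "g (x j \<omega>) < \<infinity>" if "\<omega> \<in> space M" for j \<omega>
    using prox_variational_inequality(1)[OF g_proper g_convex g_lsc _ gx0, of "1 / L"] L_pos
    using gx0 by (cases j) (simp_all add: x_0 x_Suc that)
  have unrolled: "H (x j \<omega>) - H s \<le> \<rho> ^ j * (H x0 - H s) + S j \<omega> / vartheta L \<tau>"
    if \<omega>: "\<omega> \<in> space M" for j \<omega>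
  proof (induction j)
    case 0
    then show ?case using \<omega> by (simp add: x_0 S_def)
  next
    case (Suc j)
    \<comment> \<open>One more step discounts every old error by another factor \<rho>; the newest
      error enters with exponent 0.\<close>
    have "(\<Sum>i<j. \<rho> ^ (Suc j - i - 1) * (norm (e i \<omega>))\<^sup>2) = \<rho> * S j \<omega>"
      unfolding S_def sum_distrib_left
      by (intro sum.cong) (auto simp: Suc_diff_Suc mult.assoc simp flip: power_Suc)
    then have S_Suc: "S (Suc j) \<omega> = \<rho> * S j \<omega> + (norm (e j \<omega>))\<^sup>2" by (simp add: S_def)
    have "H (x (Suc j) \<omega>) - H s \<le> \<rho> * (H (x j \<omega>) - H s + (norm (e j \<omega>))\<^sup>2 / L)"
      unfolding x_Suc[OF \<omega>] H_def \<rho>_def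
      by (rule inexact_prox_gradient_step[OF f_diff g_proper g_convex g_lsc h_eq L_pos tau_ge_1
            grad_lipschitz error_bound s dom[OF \<omega>]])
    also have "\<dots> = \<rho> * (H (x j \<omega>) - H s) + \<rho> / L * (norm (e j \<omega>))\<^sup>2"
      by (simp add: algebra_simps)
    also have "\<dots> \<le> \<rho> * (\<rho> ^ j * (H x0 - H s) + S j \<omega> / vartheta L \<tau>) + \<rho> / L * (norm (e j \<omega>))\<^sup>2"
      using Suc.IH \<rho> by (intro add_right_mono mult_left_mono) auto
    also have "\<dots> = \<rho> ^ Suc j * (H x0 - H s) + S (Suc j) \<omega> / vartheta L \<tau>"
      unfolding S_Suc \<rho>v by (simp add: algebra_simps add_divide_distrib)
    finally show ?case .
  qed
  have [measurable]: "S k \<in> borel_measurable M" unfolding S_def using e_random by measurable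
  \<comment> \<open>Monotonicity of \<open>emeasure\<close> asks for measurability of the larger set
    only, so it is enough that \<open>S k\<close> is measurable.\<close>
  have "{\<omega> \<in> space M. opt_gap h (x k \<omega>) - ereal (rate \<tau> ^ k) * opt_gap h (x 0 \<omega>) \<ge> ereal \<epsilon>}
        \<subseteq> {\<omega> \<in> space M. S k \<omega> \<ge> vartheta L \<tau> * \<epsilon>}"
  proof clarify
    fix \<omega> assume \<omega>: "\<omega> \<in> space M"
      and "ereal \<epsilon> \<le> opt_gap h (x k \<omega>) - ereal (rate \<tau> ^ k) * opt_gap h (x 0 \<omega>)"
    then have "\<epsilon> \<le> H (x k \<omega>) - H s - \<rho> ^ k * (H x0 - H s)"
      by (simp add: gap[OF dom[OF \<omega>]] gap[OF gx0] x_0 \<rho>_def)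
    then have "\<epsilon> \<le> S k \<omega> / vartheta L \<tau>" using unrolled[OF \<omega>, of k] by simp
    then show "vartheta L \<tau> * \<epsilon> \<le> S k \<omega>" using v by (simp add: field_simps)
  qed
  then have "emeasure M {\<omega> \<in> space M. opt_gap h (x k \<omega>) - ereal (rate \<tau> ^ k) * opt_gap h (x 0 \<omega>) \<ge> ereal \<epsilon>}
        \<le> emeasure M {\<omega> \<in> space M. S k \<omega> \<ge> vartheta L \<tau> * \<epsilon>}"
    by (rule emeasure_mono) measurable
  also have "\<dots> \<le> ennreal (exp (- \<theta> * (vartheta L \<tau> * \<epsilon>))) *
      (\<integral>\<^sup>+\<omega>. ennreal (exp (\<theta> * S k \<omega>)) * indicator (space M) \<omega> \<partial>M)"
    by (rule Chernoff_ineq_nn_integral_ge[OF \<theta>]) auto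
  also have "(\<integral>\<^sup>+\<omega>. ennreal (exp (\<theta> * S k \<omega>)) * indicator (space M) \<omega> \<partial>M)
      = (\<integral>\<^sup>+\<omega>. ennreal (exp (\<Sum>i<k. (\<theta> * \<rho> ^ (k - i - 1)) * (norm (e i \<omega>))\<^sup>2)) \<partial>M)"
    by (intro nn_integral_cong) (simp add: S_def sum_distrib_left mult.assoc)
  \<comment> \<open>The weights are \<open>a i = \<theta> * \<rho> ^ (k - i - 1)\<close>, the
    discount factors of \<open>S k\<close> scaled by the Chernoff parameter.\<close>
  also have "\<dots> \<le> (\<Prod>i<k. \<gamma> i (\<theta> * \<rho> ^ (k - i - 1)))"
    using \<theta> \<rho> by (intro nn_integral_exp_sum_norm_le[OF prob e_random mgf_bound]) auto
  finally show "emeasure M {\<omega> \<in> space M. opt_gap h (x k \<omega>) - ereal (rate \<tau> ^ k) * opt_gap h (x 0 \<omega>) \<ge> ereal \<epsilon>}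
      \<le> ennreal (exp (- \<theta> * vartheta L \<tau> * \<epsilon>)) * (\<Prod>i<k. \<gamma> i (\<theta> * rate \<tau> ^ (k - i - 1)))"
    by (simp add: \<rho>_def mult.assoc mult_left_mono)
qed

end
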